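(* Let $p,q\ge 0$ be integers and let $a_1,\dots,a_p,b_1,\dots,b_q$ be arbitrary constants. For every integer $N\ge 0$ put $$F_N(x)={}_{p+N+1}F_{q+N+1}\Bigl(a_1,\dots,a_p,\tfrac{\alpha+1}{\gamma},\tfrac{\alpha+\beta+1}{\gamma},\dots,\tfrac{\alpha+N\beta+1}{\gamma};\,b_1,\dots,b_q,\tfrac{\alpha+\gamma+1}{\gamma},\tfrac{\alpha+\gamma+\beta+1}{\gamma},\dots,\tfrac{\alpha+\gamma+N\beta+1}{\gamma};\,\lambda x^{\gamma}\Bigr).$$ Then, for any constants $\alpha,\beta,\eta,\lambda$ and any nonzero constant $\gamma$, $$\cosh(\eta x^\beta)\sum_{j=0}^{\infty}\frac{(\beta\eta x^\beta)^{2j}}{\prod_{m=0}^{2j}(\alpha+m\beta+1)}F_{2j}(x)-\sinh(\eta x^\beta)\sum_{j=0}^{\infty}\frac{(\beta\eta x^\beta)^{2j+1}}{\prod_{m=0}^{2j+1}(\alpha+m\beta+1)}F_{2j+1}(x)$$ $$=\frac12\left[e^{\eta x^\beta}\sum_{j=0}^{\infty}\frac{(-\beta\eta x^\beta)^{j}}{\prod_{m=0}^{j}(\alpha+m\beta+1)}F_{j}(x)+e^{-\eta x^\beta}\sum_{j=0}^{\infty}\frac{(\beta\eta x^\beta)^{j}}{\prod_{m=0}^{j}(\alpha+m\beta+1)}F_{j}(x)\right].$$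
   Context: Constants are real or complex. The generalized hypergeometric function is defined by the series $${}_pF_q(a_1,\dots,a_p;b_1,\dots,b_q;x)=\sum_{n=0}^{\infty}\frac{(a_1)_n\cdots(a_p)_n}{(b_1)_n\cdots(b_q)_n}\frac{x^n}{n!},$$ with Pochhammer symbol $(\vartheta)_n=\Gamma(\vartheta+n)/\Gamma(\vartheta)$, $(\vartheta)_0=1$. *)

theory Defs
  imports "HOL-Analysis.Analysis"
begin

definition hypergeom_term :: "complex list \<Rightarrow> complex list \<Rightarrow> complex \<Rightarrow> nat \<Rightarrow> complex" where
  "hypergeom_term a b z n =
     (\<Prod>c\<leftarrow>a. pochhammer c n) / (\<Prod>c\<leftarrow>b. pochhammer c n) * (z ^ n / fact n)"

definition hypergeom :: "complex list \<Rightarrow> complex list \<Rightarrow> complex \<Rightarrow> complex" where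
  "hypergeom a b z = (\<Sum>n. hypergeom_term a b z n)"

text \<open>
  The parameter lists of the functions \<open>F\<^sub>N\<close>; both have \<open>N + 1\<close> entries beyond \<open>a\<close> and \<open>b\<close>.
\<close>

definition upper_params ::
  "complex list \<Rightarrow> complex \<Rightarrow> complex \<Rightarrow> complex \<Rightarrow> nat \<Rightarrow> complex list" where
  "upper_params a \<alpha> \<beta> \<gamma> N =
     a @ map (\<lambda>m. (\<alpha> + of_nat m * \<beta> + 1) / \<gamma>) [0..<N + 1]"

definition lower_params ::
  "complex list \<Rightarrow> complex \<Rightarrow> complex \<Rightarrow> complex \<Rightarrow> nat \<Rightarrow> complex list" where
  "lower_params b \<alpha> \<beta> \<gamma> N =
     b @ map (\<lambda>m. (\<alpha> + \<gamma> + of_nat m * \<beta> + 1) / \<gamma>) [0..<N + 1]"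

text \<open>
  Powers of the variable are principal values; \<open>0 powr c = 0\<close> for every exponent \<open>c\<close>.
\<close>

definition F ::
  "complex list \<Rightarrow> complex list \<Rightarrow> complex \<Rightarrow> complex \<Rightarrow> complex \<Rightarrow> complex \<Rightarrow> nat \<Rightarrow> complex \<Rightarrow> complex"
where
  "F a b \<alpha> \<beta> \<gamma> l N x =
     hypergeom (upper_params a \<alpha> \<beta> \<gamma> N) (lower_params b \<alpha> \<beta> \<gamma> N) (l * x powr \<gamma>)"

definition outer_term ::
  "complex list \<Rightarrow> complex list \<Rightarrow> complex \<Rightarrow> complex \<Rightarrow> complex \<Rightarrow> complex \<Rightarrow>
   complex \<Rightarrow> complex \<Rightarrow> nat \<Rightarrow> complex"
where
  "outer_term a b \<alpha> \<beta> \<gamma> l x w j =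
     w ^ j / (\<Prod>m=0..j. \<alpha> + of_nat m * \<beta> + 1) * F a b \<alpha> \<beta> \<gamma> l j x"

end

theory Submission
  imports Defs
begin

text \<open>
  Write \<open>w = \<beta> y\<close>. Replacing \<open>w\<close> by \<open>- w\<close> multiplies the outer term of index \<open>j\<close> by
  \<open>(- 1) ^ j\<close>. If \<open>E\<close> and \<open>D\<close> are the sums over the even and the odd indices, the series at \<open>w\<close>
  and \<open>- w\<close> therefore have the sums \<open>E + D\<close> and \<open>E - D\<close>, and the identity becomes
  \<open>cosh y * E - sinh y * D = (exp y * (E - D) + exp (- y) * (E + D)) / 2\<close>, which is the definition
  of the hyperbolic functions. What needs work is the convergence of \<open>E\<close> and \<open>D\<close> when
  \<open>\<beta> / \<gamma>\<close> is not a negative real number.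

  The added parameters come in pairs that differ by one, and
  \<open>pochhammer c n / pochhammer (c + 1) n = c / (c + n)\<close>. With
  \<open>A m n = \<alpha> + 1 + m \<beta> + n \<gamma>\<close> and with \<open>t n\<close> for the terms of the hypergeometric series of the
  parameters \<open>a\<close> and \<open>b\<close> alone, the outer term is thus formally
  \<open>w ^ j * (\<Sum>n. t n / (A 0 n * \<dots> * A j n))\<close> (\<open>hypergeom_term_shifted_params\<close>).

  If \<open>\<beta> = 0\<close>, then \<open>w = 0\<close> and the outer series is finite. Otherwise the segment from \<open>\<beta>\<close> to \<open>\<gamma>\<close>
  stays away from the origin, because \<open>\<beta> / \<gamma>\<close> is not a negative real number. Hence
  \<open>norm (A m n) \<ge> c * (m + n + 1)\<close> for some \<open>c > 0\<close> (\<open>norm_lattice_point_ge\<close>). Suppose that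
  \<open>t n = O(n)\<close>. The factor \<open>A 0 n\<close> absorbs this growth, two more factors make the sum over \<open>n\<close>
  converge absolutely, and the others contribute the reciprocal of a factorial, so that the outer
  series is dominated by an exponential series (\<open>summable_norm_outer_term\<close>).

  The bound \<open>t n = O(n)\<close> always holds. Where the ratio test applies, \<open>t\<close> is even bounded
  (\<open>hypergeom_term_bounded\<close>). Where convergence of the inner series is assumed instead, the terms
  \<open>(\<alpha> + 1) * t n / A 0 n\<close> of the one with index \<open>0\<close> tend to \<open>0\<close>.
\<close>

section \<open>The parameters that differ by one\<close>

lemma pochhammer_ratio_shift:
  fixes c :: complex
  assumes "\<And>k :: nat. c + of_nat k \<noteq> 0"
  shows "pochhammer c n / pochhammer (c + 1) n = c / (c + of_nat n)"
proof -
  have "c + 1 + of_nat k \<noteq> 0" for k :: nat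
    using assms[of "Suc k"] by (simp add: ac_simps)
  then have "pochhammer (c + 1) n \<noteq> 0"
    by (auto simp: pochhammer_eq_0_iff add_eq_0_iff2)
  moreover have "(c + of_nat n) * pochhammer c n = c * pochhammer (c + 1) n"
    by (metis pochhammer_rec pochhammer_rec')
  ultimately show ?thesis
    using assms[of n] by (simp add: frac_eq_eq mult.commute)
qed

text \<open>
  The conditions on the parameters keep all linear forms away from \<open>0\<close>: for \<open>n = k + 1\<close> the
  form is \<open>\<gamma>\<close> times the sum of \<open>k\<close> and a lower parameter.
\<close>

lemma lattice_point_nonzero:
  fixes \<alpha> \<beta> \<gamma> :: complex
  assumes "\<gamma> \<noteq> 0"
    and "\<alpha> + of_nat m * \<beta> + 1 \<noteq> 0"
    and "set (lower_params b \<alpha> \<beta> \<gamma> m) \<inter> \<int>\<^sub>\<le>\<^sub>0 = {}"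
  shows "\<alpha> + of_nat m * \<beta> + 1 + of_nat n * \<gamma> \<noteq> 0"
proof (cases n)
  case 0
  then show ?thesis using assms(2) by simp
next
  case (Suc k)
  have "(\<alpha> + \<gamma> + of_nat m * \<beta> + 1) / \<gamma> \<in> set (lower_params b \<alpha> \<beta> \<gamma> m)"
    by (simp add: lower_params_def)
  then have "(\<alpha> + \<gamma> + of_nat m * \<beta> + 1) / \<gamma> \<notin> \<int>\<^sub>\<le>\<^sub>0"
    using assms(3) by blast
  then have "(\<alpha> + \<gamma> + of_nat m * \<beta> + 1) / \<gamma> \<noteq> - of_nat k"
    by (metis minus_of_nat_in_nonpos_Ints)
  then have "\<gamma> * ((\<alpha> + \<gamma> + of_nat m * \<beta> + 1) / \<gamma> + of_nat k) \<noteq> 0"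
    using \<open>\<gamma> \<noteq> 0\<close> by (simp add: add_eq_0_iff2)
  also have "\<gamma> * ((\<alpha> + \<gamma> + of_nat m * \<beta> + 1) / \<gamma> + of_nat k) =
      \<alpha> + of_nat m * \<beta> + 1 + of_nat n * \<gamma>"
    using \<open>\<gamma> \<noteq> 0\<close> unfolding Suc by (simp add: field_simps)
  finally show ?thesis .
qed

text \<open>
  The numerators on the right do not depend on \<open>n\<close>. They are the product by which the outer
  term is divided, so they cancel there.
\<close>

lemma hypergeom_term_shifted_params:
  fixes \<alpha> \<beta> \<gamma> z :: complex
  assumes "\<gamma> \<noteq> 0" and nz: "\<And>m n :: nat. \<alpha> + of_nat m * \<beta> + 1 + of_nat n * \<gamma> \<noteq> 0"
  shows "hypergeom_term (upper_params a \<alpha> \<beta> \<gamma> N) (lower_params b \<alpha> \<beta> \<gamma> N) z n =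
         hypergeom_term a b z n *
         ((\<Prod>m=0..N. \<alpha> + of_nat m * \<beta> + 1) / (\<Prod>m=0..N. \<alpha> + of_nat m * \<beta> + 1 + of_nat n * \<gamma>))"
proof -
  define c where "c m = (\<alpha> + of_nat m * \<beta> + 1) / \<gamma>" for m :: nat
  have c_plus: "c m + of_nat k = (\<alpha> + of_nat m * \<beta> + 1 + of_nat k * \<gamma>) / \<gamma>" for m k :: nat
    using \<open>\<gamma> \<noteq> 0\<close> by (simp add: c_def field_simps)
  have c_lower: "(\<alpha> + \<gamma> + of_nat m * \<beta> + 1) / \<gamma> = c m + 1" for m :: nat
    using \<open>\<gamma> \<noteq> 0\<close> by (simp add: c_def field_simps)
  have ratio: "pochhammer (c m) n / pochhammer (c m + 1) n =
      (\<alpha> + of_nat m * \<beta> + 1) / (\<alpha> + of_nat m * \<beta> + 1 + of_nat n * \<gamma>)" for m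
  proof -
    have "c m + of_nat k \<noteq> 0" for k :: nat
      using nz[of m k] \<open>\<gamma> \<noteq> 0\<close> unfolding c_plus by simp
    then have "pochhammer (c m) n / pochhammer (c m + 1) n = c m / (c m + of_nat n)"
      by (rule pochhammer_ratio_shift)
    also have "\<dots> = (\<alpha> + of_nat m * \<beta> + 1) / (\<alpha> + of_nat m * \<beta> + 1 + of_nat n * \<gamma>)"
      unfolding c_plus using \<open>\<gamma> \<noteq> 0\<close> by (simp add: c_def)
    finally show ?thesis .
  qed
  have list_prod: "prod_list (map f [0..<N + 1]) = (\<Prod>m=0..N. f m)" for f :: "nat \<Rightarrow> complex"
    by (simp flip: prod.distinct_set_conv_list add: atLeastLessThanSuc_atLeastAtMost del: upt_Suc)
  have upper: "(\<Prod>d\<leftarrow>upper_params a \<alpha> \<beta> \<gamma> N. pochhammer d n) =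
      (\<Prod>d\<leftarrow>a. pochhammer d n) * (\<Prod>m=0..N. pochhammer (c m) n)"
    unfolding upper_params_def c_def[symmetric] map_append map_map prod_list.append o_def
      list_prod ..
  have lower: "(\<Prod>d\<leftarrow>lower_params b \<alpha> \<beta> \<gamma> N. pochhammer d n) =
      (\<Prod>d\<leftarrow>b. pochhammer d n) * (\<Prod>m=0..N. pochhammer (c m + 1) n)"
    unfolding lower_params_def c_lower map_append map_map prod_list.append o_def
      list_prod ..
  have "(\<Prod>m=0..N. pochhammer (c m) n) / (\<Prod>m=0..N. pochhammer (c m + 1) n) =
      (\<Prod>m=0..N. \<alpha> + of_nat m * \<beta> + 1) / (\<Prod>m=0..N. \<alpha> + of_nat m * \<beta> + 1 + of_nat n * \<gamma>)"
    unfolding prod_dividef[symmetric] ratio ..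
  then show ?thesis
    unfolding hypergeom_term_def upper lower times_divide_times_eq[symmetric]
    by (simp only: mult_ac)
qed

section \<open>Growth of the linear forms\<close>

text \<open>
  After normalising to \<open>s + t = 1\<close> the combination runs through the segment from \<open>\<beta>\<close> to \<open>\<gamma>\<close>,
  a compact set. It contains the origin only if \<open>\<beta> / \<gamma>\<close> is real and nonpositive.
\<close>

lemma norm_combination_ge:
  fixes \<beta> \<gamma> :: complex
  assumes "\<gamma> \<noteq> 0" and "\<beta> / \<gamma> \<notin> \<real>\<^sub>\<le>\<^sub>0"
  obtains \<delta> where "\<delta> > 0" and "\<And>s t. s \<ge> 0 \<Longrightarrow> t \<ge> 0 \<Longrightarrow> norm (s *\<^sub>R \<beta> + t *\<^sub>R \<gamma>) \<ge> \<delta> * (s + t)"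
proof -
  have "0 \<notin> closed_segment \<beta> \<gamma>"
  proof
    assume "0 \<in> closed_segment \<beta> \<gamma>"
    then obtain u where u: "0 \<le> u" "u \<le> 1" and 0: "0 = (1 - u) *\<^sub>R \<beta> + u *\<^sub>R \<gamma>"
      by (auto simp: closed_segment_def)
    have "u \<noteq> 1"
      using 0 \<open>\<gamma> \<noteq> 0\<close> by auto
    then have "\<beta> / \<gamma> = of_real (- u / (1 - u))"
      using 0 \<open>\<gamma> \<noteq> 0\<close> by (simp add: scaleR_conv_of_real field_simps add_eq_0_iff2)
    moreover have "- u / (1 - u) \<le> 0"
      using u by (simp add: field_simps)
    ultimately show False
      using assms(2) nonpos_Reals_of_real_iff by metis
  qed
  then obtain \<delta> where "\<delta> > 0" and \<delta>: "\<And>v. v \<in> closed_segment \<beta> \<gamma> \<Longrightarrow> \<delta> \<le> norm v"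
    using separate_point_closed[of "closed_segment \<beta> \<gamma>" 0] by (auto simp: closed_segment)
  show thesis
  proof
    fix s t :: real
    assume "s \<ge> 0" "t \<ge> 0"
    show "norm (s *\<^sub>R \<beta> + t *\<^sub>R \<gamma>) \<ge> \<delta> * (s + t)"
    proof (cases "s + t = 0")
      case False
      with \<open>s \<ge> 0\<close> \<open>t \<ge> 0\<close> have pos: "s + t > 0"
        by simp
      have "1 - t / (s + t) = s / (s + t)"
        using pos by (simp add: field_simps)
      then have "(s / (s + t)) *\<^sub>R \<beta> + (t / (s + t)) *\<^sub>R \<gamma> \<in> closed_segment \<beta> \<gamma>"
        unfolding closed_segment_def using pos \<open>s \<ge> 0\<close> \<open>t \<ge> 0\<close>
        by (auto intro!: exI[of _ "t / (s + t)"])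
      then have "\<delta> * (s + t) \<le>
          norm ((s / (s + t)) *\<^sub>R \<beta> + (t / (s + t)) *\<^sub>R \<gamma>) * (s + t)"
        using pos by (intro mult_right_mono \<delta>) auto
      also have "\<dots> = norm ((s + t) *\<^sub>R ((s / (s + t)) *\<^sub>R \<beta> + (t / (s + t)) *\<^sub>R \<gamma>))"
        using pos by simp
      also have "\<dots> = norm (s *\<^sub>R \<beta> + t *\<^sub>R \<gamma>)"
        using pos by (simp add: scaleR_add_right)
      finally show ?thesis .
    qed simp
  qed fact
qed

text \<open>
  Far from the origin the summand \<open>\<alpha> + 1\<close> is negligible and the preceding bound with half the
  constant survives. Only finitely many pairs \<open>(m, n)\<close> remain, and none of them gives \<open>0\<close>.
\<close>

lemma norm_lattice_point_ge:
  fixes \<alpha> \<beta> \<gamma> :: complex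
  assumes "\<gamma> \<noteq> 0" and "\<beta> / \<gamma> \<notin> \<real>\<^sub>\<le>\<^sub>0"
    and nz: "\<And>m n :: nat. \<alpha> + of_nat m * \<beta> + 1 + of_nat n * \<gamma> \<noteq> 0"
  obtains c where "c > 0"
    and "\<And>m n :: nat. norm (\<alpha> + of_nat m * \<beta> + 1 + of_nat n * \<gamma>) \<ge> c * real (m + n + 1)"
proof -
  define A where "A m n = \<alpha> + of_nat m * \<beta> + 1 + of_nat n * \<gamma>" for m n :: nat
  obtain \<delta> where "\<delta> > 0"
    and \<delta>: "\<And>s t. s \<ge> 0 \<Longrightarrow> t \<ge> 0 \<Longrightarrow> norm (s *\<^sub>R \<beta> + t *\<^sub>R \<gamma>) \<ge> \<delta> * (s + t)"
    using norm_combination_ge[OF assms(1,2)] by blast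
  \<comment> \<open>The threshold is where \<open>\<delta> * (m + n) - norm (\<alpha> + 1)\<close> reaches \<open>\<delta> / 2 * (m + n + 1)\<close>.\<close>
  obtain K :: nat where K: "real K > (\<delta> + 2 * norm (\<alpha> + 1)) / \<delta>"
    using reals_Archimedean2 by blast
  have far: "norm (A m n) \<ge> \<delta> / 2 * real (m + n + 1)" if "m + n \<ge> K" for m n
  proof -
    have "\<delta> + 2 * norm (\<alpha> + 1) < \<delta> * real K"
      using K \<open>\<delta> > 0\<close> by (simp add: field_simps)
    also have "\<dots> \<le> \<delta> * real (m + n)"
      using that \<open>\<delta> > 0\<close> by (intro mult_left_mono) auto
    finally have "\<delta> / 2 * real (m + n + 1) \<le> \<delta> * (real m + real n) - norm (\<alpha> + 1)"
      by (simp add: field_simps)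
    also have "\<dots> \<le> norm (real m *\<^sub>R \<beta> + real n *\<^sub>R \<gamma>) - norm (\<alpha> + 1)"
      using \<delta>[of "real m" "real n"] by simp
    also have "\<dots> \<le> norm (real m *\<^sub>R \<beta> + real n *\<^sub>R \<gamma> + (\<alpha> + 1))"
      by (rule norm_diff_ineq)
    also have "real m *\<^sub>R \<beta> + real n *\<^sub>R \<gamma> + (\<alpha> + 1) = A m n"
      by (simp add: A_def scaleR_conv_of_real)
    finally show ?thesis .
  qed
  define near where "near = (\<lambda>(m, n). norm (A m n) / real (m + n + 1)) ` ({..K} \<times> {..K})"
  define c where "c = Min (insert (\<delta> / 2) near)"
  have "finite near"
    by (simp add: near_def)
  have "c > 0"
    unfolding c_def using \<open>finite near\<close> \<open>\<delta> > 0\<close> nz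
    by (subst Min_gr_iff) (auto simp: near_def A_def)
  moreover have "norm (A m n) \<ge> c * real (m + n + 1)" for m n
  proof (cases "m + n \<ge> K")
    case True
    have "c \<le> \<delta> / 2"
      unfolding c_def using \<open>finite near\<close> by (intro Min_le) auto
    then have "c * real (m + n + 1) \<le> \<delta> / 2 * real (m + n + 1)"
      by (intro mult_right_mono) auto
    also have "\<dots> \<le> norm (A m n)"
      by (rule far[OF True])
    finally show ?thesis .
  next
    case False
    then have "norm (A m n) / real (m + n + 1) \<in> near"
      unfolding near_def by (intro image_eqI[of _ _ "(m, n)"]) auto
    then have "c \<le> norm (A m n) / real (m + n + 1)"
      unfolding c_def using \<open>finite near\<close> by (intro Min_le) auto
    then show ?thesis
      by (simp add: pos_le_divide_eq del: of_nat_add)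
  qed
  ultimately show thesis
    using that by (simp add: A_def)
qed

section \<open>Growth of the hypergeometric terms\<close>

lemma hypergeom_term_Suc:
  "hypergeom_term a b z (Suc n) =
   (\<Prod>c\<leftarrow>a. c + of_nat n) / (\<Prod>c\<leftarrow>b. c + of_nat n) * (z / of_nat (Suc n)) * hypergeom_term a b z n"
proof -
  have *: "(\<Prod>c\<leftarrow>d. pochhammer c (Suc n)) = (\<Prod>c\<leftarrow>d. c + of_nat n) * (\<Prod>c\<leftarrow>d. pochhammer c n)"
    for d :: "complex list"
    by (induction d) (simp_all add: pochhammer_rec')
  show ?thesis
    unfolding hypergeom_term_def * by (simp add: mult_ac)
qed

text \<open>
  Dividing by a power of \<open>Suc n\<close> instead of \<open>n\<close> avoids a division by zero at \<open>n = 0\<close> and matches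
  the factor \<open>z / Suc n\<close> in the quotient of consecutive terms.
\<close>

lemma prod_list_shift_asymp:
  fixes d :: "complex list"
  shows "(\<lambda>n. (\<Prod>c\<leftarrow>d. c + of_nat n) / of_nat (Suc n) ^ length d) \<longlonglongrightarrow> 1"
proof (induction d)
  case (Cons c d)
  have "(\<lambda>n. c / of_nat (Suc n) + of_nat n / of_nat (Suc n)) \<longlonglongrightarrow> 0 + 1"
    by (intro tendsto_add LIMSEQ_n_over_Suc_n LIMSEQ_Suc[OF lim_const_over_n])
  from tendsto_mult[OF this Cons.IH] show ?case
    by (simp add: add_divide_distrib[symmetric] del: of_nat_Suc)
qed simp

text \<open>
  The quotient of consecutive terms tends to \<open>0\<close> if \<open>length a \<le> length b\<close> and to \<open>z\<close> if
  \<open>length a = length b + 1\<close>. Its modulus is therefore eventually below \<open>1\<close>, and from then on the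
  moduli of the terms decrease.
\<close>

lemma hypergeom_term_bounded:
  assumes "length a \<le> length b \<or> length a = length b + 1 \<and> norm z < 1"
  shows "Bseq (hypergeom_term a b z)"
proof -
  define r where "r n = (\<Prod>c\<leftarrow>a. c + of_nat n) / (\<Prod>c\<leftarrow>b. c + of_nat n) * (z / of_nat (Suc n))"
    for n
  define \<rho> where "\<rho> = (if length a \<le> length b then 0 else z)"
  have quot: "(\<lambda>n. ((\<Prod>c\<leftarrow>a. c + of_nat n) / of_nat (Suc n) ^ length a) /
      ((\<Prod>c\<leftarrow>b. c + of_nat n) / of_nat (Suc n) ^ length b)) \<longlonglongrightarrow> 1"
    using tendsto_divide[OF prod_list_shift_asymp[of a] prod_list_shift_asymp[of b]] by simp
  have "(\<lambda>n. z * of_nat (Suc n) ^ length a / of_nat (Suc n) ^ (length b + 1)) \<longlonglongrightarrow> \<rho>"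
  proof (cases "length a \<le> length b")
    case True
    define k where "k = length b - length a"
    have *: "z * of_nat (Suc n) ^ length a / of_nat (Suc n) ^ (length b + 1) =
        z / of_nat (Suc n) * (1 / of_nat (Suc n)) ^ k" for n
    proof -
      have "(of_nat (Suc n) :: complex) ^ (length b + 1) =
          of_nat (Suc n) ^ length a * of_nat (Suc n) ^ k * of_nat (Suc n)"
        using True unfolding k_def by (simp add: power_add[symmetric])
      then show ?thesis
        by (simp add: power_divide del: of_nat_Suc)
    qed
    have "(\<lambda>n. z / of_nat (Suc n) * (1 / of_nat (Suc n)) ^ k) \<longlonglongrightarrow> 0 * 0 ^ k"
      by (intro tendsto_mult tendsto_power LIMSEQ_Suc[OF lim_const_over_n])
    then show ?thesis
      unfolding * using True by (simp add: \<rho>_def)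
  next
    case False
    with assms have "length a = length b + 1"
      by simp
    then show ?thesis
      by (simp add: \<rho>_def del: of_nat_Suc)
  qed
  from tendsto_mult[OF quot this] have "r \<longlonglongrightarrow> \<rho>"
    unfolding r_def by (simp add: mult_ac del: of_nat_Suc)
  moreover have "norm \<rho> < 1"
    using assms by (auto simp: \<rho>_def)
  ultimately have "\<forall>\<^sub>F n in sequentially. norm (r n) < 1"
    by (intro order_tendstoD(2)[OF tendsto_norm])
  then obtain M where M: "\<And>n. n \<ge> M \<Longrightarrow> norm (r n) < 1"
    by (auto simp: eventually_sequentially)
  have "norm (hypergeom_term a b z (M + k)) \<le> norm (hypergeom_term a b z M)" for k
  proof (induction k)
    case (Suc k)
    have "norm (hypergeom_term a b z (M + Suc k)) =
        norm (r (M + k)) * norm (hypergeom_term a b z (M + k))"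
      by (simp only: add_Suc_right hypergeom_term_Suc r_def norm_mult)
    also have "\<dots> \<le> 1 * norm (hypergeom_term a b z (M + k))"
      using M[of "M + k"] by (intro mult_right_mono) auto
    finally show ?case
      using Suc.IH by simp
  qed simp
  then have "Bseq (\<lambda>k. hypergeom_term a b z (k + M))"
    by (intro BseqI') (simp add: add.commute)
  then show ?thesis
    by (rule Bseq_offset)
qed

section \<open>Convergence of the outer series\<close>

text \<open>
  Three of the factors are bounded below by \<open>n + 1\<close>, namely the first and the last two; one power
  of \<open>n + 1\<close> is to absorb the growth of the hypergeometric terms, and the other two make the sum
  over \<open>n\<close> converge. The remaining factors, \<open>m = 1, \<dots>, i\<close>, exceed \<open>m\<close>. Three powers of \<open>n + 1\<close>
  require at least three factors, whence the shift of the index by \<open>2\<close>.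
\<close>

lemma prod_lattice_weight_ge:
  "(\<Prod>m=0..i + 2. real (m + n + 1)) \<ge> real (n + 1) * (real (n + 1) ^ 2 * fact i)"
proof -
  have "(\<Prod>m=0..i. real (m + n + 1)) \<ge> real (n + 1) * fact i"
  proof (induction i)
    case (Suc i)
    have "real (n + 1) * fact i * real (Suc i) \<le>
        (\<Prod>m=0..i. real (m + n + 1)) * real (Suc i + n + 1)"
      using Suc.IH by (intro mult_mono) (auto intro!: prod_nonneg)
    then show ?case
      by (simp add: mult_ac)
  qed simp
  then have "real (n + 1) * fact i * (real (n + 1) * real (n + 1)) \<le>
      (\<Prod>m=0..i. real (m + n + 1)) * (real (i + 1 + n + 1) * real (i + 2 + n + 1))"
    by (intro mult_mono) (auto intro!: prod_nonneg)
  then show ?thesis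
    by (simp add: power2_eq_square mult_ac)
qed

text \<open>
  The hypergeometric terms are allowed to grow linearly, because convergence of the inner series of
  index \<open>0\<close> forces no more than \<open>o(n)\<close>. The inner series of index \<open>0\<close> and \<open>1\<close> are
  not controlled by it, but two terms do not affect the convergence of the outer series.
\<close>

lemma summable_norm_outer_term:
  fixes \<alpha> \<beta> \<gamma> l x w :: complex
  assumes "\<gamma> \<noteq> 0" and "\<beta> / \<gamma> \<notin> \<real>\<^sub>\<le>\<^sub>0"
    and nz: "\<And>m n :: nat. \<alpha> + of_nat m * \<beta> + 1 + of_nat n * \<gamma> \<noteq> 0"
    and bounded: "Bseq (\<lambda>n. hypergeom_term a b (l * x powr \<gamma>) n / of_nat (n + 1))"
  shows "summable (\<lambda>j. norm (outer_term a b \<alpha> \<beta> \<gamma> l x w j))"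
proof -
  define A where "A m n = \<alpha> + of_nat m * \<beta> + 1 + of_nat n * \<gamma>" for m n :: nat
  define t where "t = hypergeom_term a b (l * x powr \<gamma>)"
  define P where "P j = (\<Prod>m=0..j. \<alpha> + of_nat m * \<beta> + 1)" for j
  obtain c where "c > 0" and c: "\<And>m n. norm (A m n) \<ge> c * real (m + n + 1)"
    using norm_lattice_point_ge[OF assms(1-3)] unfolding A_def by blast
  obtain B where "B > 0" and "\<forall>n. norm (t n / of_nat (n + 1)) \<le> B"
    using bounded unfolding t_def by (rule BseqE)
  then have B: "norm (t n) \<le> B * real (n + 1)" for n
    unfolding norm_divide norm_of_nat by (simp add: pos_divide_le_eq)
  have P_nz: "P j \<noteq> 0" for j
    using nz[of _ 0] by (simp add: P_def)
  define g where "g n = 1 / real (n + 1) ^ 2" for n :: nat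
  have "summable g"
    using summable_ignore_initial_segment[OF inverse_power_summable[of 2], of 1]
    unfolding g_def by (simp add: inverse_eq_divide)
  \<comment> \<open>There are \<open>i + 3\<close> factors \<open>A m n\<close>, each of which contributes one \<open>c\<close>.\<close>
  have inner: "norm (t n * (P (i + 2) / (\<Prod>m=0..i + 2. A m n))) \<le>
      norm (P (i + 2)) * B / (c ^ (i + 3) * fact i) * g n" for i n
  proof -
    have "c ^ (i + 3) * (real (n + 1) * (real (n + 1) ^ 2 * fact i)) \<le>
        c ^ (i + 3) * (\<Prod>m=0..i + 2. real (m + n + 1))"
      using \<open>c > 0\<close> by (intro mult_left_mono prod_lattice_weight_ge) auto
    also have "\<dots> = (\<Prod>m=0..i + 2. c * real (m + n + 1))"
      unfolding prod.distrib by (simp add: eval_nat_numeral)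
    also have "\<dots> \<le> (\<Prod>m=0..i + 2. norm (A m n))"
      using c \<open>c > 0\<close> by (intro prod_mono) auto
    finally have den: "c ^ (i + 3) * (real (n + 1) * (real (n + 1) ^ 2 * fact i)) \<le>
        (\<Prod>m=0..i + 2. norm (A m n))" .
    have "norm (t n * (P (i + 2) / (\<Prod>m=0..i + 2. A m n))) =
        norm (P (i + 2)) * norm (t n) / (\<Prod>m=0..i + 2. norm (A m n))"
      by (simp add: norm_mult norm_divide prod_norm)
    also have "\<dots> \<le> norm (P (i + 2)) * (B * real (n + 1)) /
        (c ^ (i + 3) * (real (n + 1) * (real (n + 1) ^ 2 * fact i)))"
      using den B[of n] \<open>c > 0\<close> \<open>B > 0\<close>
      by (intro frac_le mult_left_mono) (auto intro!: mult_pos_pos simp del: of_nat_Suc)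
    also have "\<dots> = norm (P (i + 2)) * B / (c ^ (i + 3) * fact i) * g n"
      unfolding g_def by (simp add: divide_simps mult_ac)
    finally show ?thesis .
  qed
  have F_le: "norm (F a b \<alpha> \<beta> \<gamma> l (i + 2) x) \<le>
      norm (P (i + 2)) * B / (c ^ (i + 3) * fact i) * suminf g" for i
  proof -
    have "F a b \<alpha> \<beta> \<gamma> l (i + 2) x = (\<Sum>n. t n * (P (i + 2) / (\<Prod>m=0..i + 2. A m n)))"
      unfolding F_def hypergeom_def hypergeom_term_shifted_params[OF \<open>\<gamma> \<noteq> 0\<close> nz]
        t_def P_def A_def ..
    also have "norm \<dots> \<le> (\<Sum>n. norm (P (i + 2)) * B / (c ^ (i + 3) * fact i) * g n)"
      using inner summable_mult[OF \<open>summable g\<close>] by (rule norm_suminf_le)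
    also have "\<dots> = norm (P (i + 2)) * B / (c ^ (i + 3) * fact i) * suminf g"
      by (rule suminf_mult[OF \<open>summable g\<close>])
    finally show ?thesis .
  qed
  have bound: "norm (norm (outer_term a b \<alpha> \<beta> \<gamma> l x w (i + 2))) \<le>
      B * suminf g * norm w ^ 2 / c ^ 3 * (inverse (fact i) * (norm w / c) ^ i)" for i
  proof -
    have "norm (outer_term a b \<alpha> \<beta> \<gamma> l x w (i + 2)) =
        norm w ^ (i + 2) / norm (P (i + 2)) * norm (F a b \<alpha> \<beta> \<gamma> l (i + 2) x)"
      unfolding outer_term_def P_def by (simp only: norm_mult norm_divide norm_power)
    also have "\<dots> \<le> norm w ^ (i + 2) / norm (P (i + 2)) *
        (norm (P (i + 2)) * B / (c ^ (i + 3) * fact i) * suminf g)"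
      by (intro mult_left_mono F_le) auto
    also have "\<dots> = B * suminf g * norm w ^ 2 / c ^ 3 * (inverse (fact i) * (norm w / c) ^ i)"
      using P_nz[of "i + 2"] \<open>c > 0\<close>
      by (simp add: power_add power_divide field_simps del: add_2_eq_Suc')
    finally show ?thesis by simp
  qed
  have "summable (\<lambda>i. norm (outer_term a b \<alpha> \<beta> \<gamma> l x w (i + 2)))"
    by (rule summable_comparison_test'[OF summable_mult[OF summable_exp] bound])
  then show ?thesis
    by (rule summable_iff_shift[THEN iffD1])
qed

section \<open>Separating even and odd indices\<close>

text \<open>
  The two subseries may converge only conditionally; each is padded with zeros and the padded
  series are added termwise, so that no rearrangement is involved.
\<close>

lemma sums_even_odd:
  fixes f :: "nat \<Rightarrow> 'a::real_normed_vector"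
  assumes "summable (\<lambda>j. f (2 * j))" and "summable (\<lambda>j. f (2 * j + 1))"
  shows "f sums ((\<Sum>j. f (2 * j)) + (\<Sum>j. f (2 * j + 1)))"
proof -
  have "(\<lambda>n. if even n then f n else 0) sums (\<Sum>j. f (2 * j))"
    using summable_sums[OF assms(1)]
    by (subst sums_mono_reindex[of "\<lambda>j. 2 * j", symmetric]) (auto simp: strict_mono_def)
  moreover have "(\<lambda>n. if even n then 0 else f n) sums (\<Sum>j. f (2 * j + 1))"
    using summable_sums[OF assms(2)]
    by (subst sums_mono_reindex[of "\<lambda>j. 2 * j + 1", symmetric])
      (auto simp: strict_mono_def elim: oddE)
  ultimately have "(\<lambda>n. (if even n then f n else 0) + (if even n then 0 else f n)) sums
      ((\<Sum>j. f (2 * j)) + (\<Sum>j. f (2 * j + 1)))"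
    by (rule sums_add)
  then show ?thesis
    by (rule sums_cong[THEN iffD1, rotated]) simp
qed

lemma summable_norm_reindex:
  fixes f :: "nat \<Rightarrow> 'a::banach" and g :: "nat \<Rightarrow> nat"
  assumes "summable (\<lambda>j. norm (f j))" and "inj g"
  shows "summable (\<lambda>j. f (g j))"
proof -
  have "summable ((\<lambda>j. norm (f j)) \<circ> g)"
    using assms by (intro summable_reindex) auto
  then show ?thesis
    unfolding o_def by (rule summable_norm_cancel)
qed

section \<open>The identity\<close>

(* The hypotheses say that all expressions make sense: no denominator vanishes and all series
   converge.  The inner series converge in the first two cases listed by the ratio test; the third
   covers terminating series and the boundary of the unit disc.  The outer series then converge
   unless beta / gamma is a negative real number.  In that exceptional case the numbers
   alpha + m beta + 1 + n gamma may come so close to 0 that the outer series diverge, so only there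
   is their convergence assumed. *)
theorem theorem1:
  fixes a b :: "complex list" and \<alpha> \<beta> \<gamma> \<eta> l x :: complex
  defines "y \<equiv> \<eta> * x powr \<beta>"
  defines "T \<equiv> outer_term a b \<alpha> \<beta> \<gamma> l x"
  assumes "\<gamma> \<noteq> 0"
    and "\<And>m :: nat. \<alpha> + of_nat m * \<beta> + 1 \<noteq> 0"
    and "\<And>N. set (lower_params b \<alpha> \<beta> \<gamma> N) \<inter> \<int>\<^sub>\<le>\<^sub>0 = {}"
    and "length a \<le> length b \<or>
         length a = length b + 1 \<and> norm (l * x powr \<gamma>) < 1 \<or>
         (\<forall>N. summable (hypergeom_term (upper_params a \<alpha> \<beta> \<gamma> N) (lower_params b \<alpha> \<beta> \<gamma> N)
                                    (l * x powr \<gamma>)))"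
    and "\<beta> / \<gamma> \<in> \<real>\<^sub>\<le>\<^sub>0 - {0} \<Longrightarrow>
          summable (\<lambda>j. T (\<beta> * y) (2 * j)) \<and> summable (\<lambda>j. T (\<beta> * y) (2 * j + 1))"
  shows "summable (\<lambda>j. T (\<beta> * y) (2 * j)) \<and> summable (\<lambda>j. T (\<beta> * y) (2 * j + 1)) \<and>
         summable (\<lambda>j. T (- \<beta> * y) j) \<and> summable (\<lambda>j. T (\<beta> * y) j) \<and>
         cosh y * (\<Sum>j. T (\<beta> * y) (2 * j)) - sinh y * (\<Sum>j. T (\<beta> * y) (2 * j + 1)) =
         1 / 2 * (exp y * (\<Sum>j. T (- \<beta> * y) j) + exp (- y) * (\<Sum>j. T (\<beta> * y) j))"
proof -
  define z where "z = l * x powr \<gamma>"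
  define w where "w = \<beta> * y"
  note \<gamma> = assms(3) and params = assms(4,5) and conv = assms(6) and exceptional = assms(7)
  have nz: "\<alpha> + of_nat m * \<beta> + 1 + of_nat n * \<gamma> \<noteq> 0" for m n :: nat
    using \<gamma> params by (rule lattice_point_nonzero)
  have split: "summable (\<lambda>j. T w (2 * j)) \<and> summable (\<lambda>j. T w (2 * j + 1))"
  proof (cases "\<beta> / \<gamma> \<in> \<real>\<^sub>\<le>\<^sub>0 - {0}")
    case True
    then show ?thesis
      unfolding w_def by (rule exceptional)
  next
    case False
    have "summable (\<lambda>j. norm (T w j))"
    proof (cases "\<beta> = 0")
      case True
      (* The linear forms do not grow with m if beta = 0, but then w = 0 and only the outer term of
         index 0 remains. *)
      then have "norm (T w j) = 0" if "j \<notin> {0}" for j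
        using that by (simp add: T_def outer_term_def w_def)
      then show ?thesis
        by (intro summable_finite[of "{0}"]) auto
    next
      case nonzero: False
      have "Bseq (\<lambda>n. hypergeom_term a b z n / of_nat (n + 1))"
      proof (cases "length a \<le> length b \<or> length a = length b + 1 \<and> norm z < 1")
        case True
        then obtain B where B: "\<forall>n. norm (hypergeom_term a b z n) \<le> B"
          by (rule BseqE[OF hypergeom_term_bounded])
        have "norm (hypergeom_term a b z n / of_nat (n + 1)) \<le> B" for n
        proof -
          have "norm (hypergeom_term a b z n / of_nat (n + 1)) =
              norm (hypergeom_term a b z n) / real (n + 1)"
            by (simp only: norm_divide norm_of_nat)
          also have "\<dots> \<le> norm (hypergeom_term a b z n) / 1"
            by (intro divide_left_mono) auto
          also have "\<dots> \<le> B"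
            using B by simp
          finally show ?thesis .
        qed
        then show ?thesis
          by (rule BseqI')
      next
        case False
        then have "summable (hypergeom_term (upper_params a \<alpha> \<beta> \<gamma> 0) (lower_params b \<alpha> \<beta> \<gamma> 0) z)"
          using conv unfolding z_def by blast
        then have "Bseq (\<lambda>n. hypergeom_term a b z n * ((\<alpha> + 1) / (\<alpha> + 1 + of_nat n * \<gamma>)))"
          unfolding hypergeom_term_shifted_params[OF \<gamma> nz]
          by (intro convergent_imp_Bseq convergentI[OF summable_LIMSEQ_zero]) simp
        \<comment> \<open>Multiplying by \<open>\<alpha> + 1 + n \<gamma>\<close> again costs a factor of order \<open>n + 1\<close>.\<close>
        moreover have "Bseq (\<lambda>n. (\<alpha> + 1 + of_nat n * \<gamma>) / of_nat (n + 1) / (\<alpha> + 1))"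
        proof -
          have "(\<lambda>n. ((\<alpha> + 1) / of_nat (Suc n) + of_nat n / of_nat (Suc n) * \<gamma>) / (\<alpha> + 1))
              \<longlonglongrightarrow> (0 + 1 * \<gamma>) / (\<alpha> + 1)"
            using params(1)[of 0]
            by (intro tendsto_intros LIMSEQ_n_over_Suc_n LIMSEQ_Suc[OF lim_const_over_n]) simp
          then have "convergent (\<lambda>n. (\<alpha> + 1 + of_nat n * \<gamma>) / of_nat (n + 1) / (\<alpha> + 1))"
            by (intro convergentI) (simp add: add_divide_distrib)
          then show ?thesis
            by (rule convergent_imp_Bseq)
        qed
        ultimately have "Bseq (\<lambda>n. hypergeom_term a b z n * ((\<alpha> + 1) / (\<alpha> + 1 + of_nat n * \<gamma>)) *
            ((\<alpha> + 1 + of_nat n * \<gamma>) / of_nat (n + 1) / (\<alpha> + 1)))"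
          by (rule Bseq_mult)
        moreover have "hypergeom_term a b z n * ((\<alpha> + 1) / (\<alpha> + 1 + of_nat n * \<gamma>)) *
            ((\<alpha> + 1 + of_nat n * \<gamma>) / of_nat (n + 1) / (\<alpha> + 1)) =
            hypergeom_term a b z n / of_nat (n + 1)" for n
          using nz[of 0 n] params(1)[of 0] by simp
        ultimately show ?thesis
          by simp
      qed
      then show ?thesis
        using False nonzero \<gamma> nz unfolding T_def z_def
        by (intro summable_norm_outer_term) auto
    qed
    then show ?thesis
      by (auto intro!: summable_norm_reindex[of "T w"] injI)
  qed
  define E where "E = (\<Sum>j. T w (2 * j))"
  define D where "D = (\<Sum>j. T w (2 * j + 1))"
  have parity: "T (- w) (2 * j) = T w (2 * j)" "T (- w) (2 * j + 1) = - T w (2 * j + 1)" for j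
    by (simp_all add: T_def outer_term_def)
  have plus: "T w sums (E + D)"
    using split unfolding E_def D_def by (intro sums_even_odd) auto
  have "T (- w) sums ((\<Sum>j. T (- w) (2 * j)) + (\<Sum>j. T (- w) (2 * j + 1)))"
    using split by (intro sums_even_odd) (simp_all only: parity summable_minus_iff)
  then have minus: "T (- w) sums (E - D)"
    using split unfolding parity E_def D_def by (simp add: suminf_minus)
  have "cosh y * E - sinh y * D = 1 / 2 * (exp y * (E - D) + exp (- y) * (E + D))"
    by (simp add: cosh_def sinh_def scaleR_conv_of_real field_simps)
  then show ?thesis
    using split sums_summable[OF plus] sums_summable[OF minus]
      sums_unique[OF plus] sums_unique[OF minus]
    by (simp add: w_def E_def D_def)
qed

end
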